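(* Let $\mathcal{X}\subseteq\mathbb{R}^n$, let $H(\mathbf{x},\boldsymbol{\xi})$ be a real-valued loss function of the decision $\mathbf{x}\in\mathbb{R}^n$ and the uncertain parameter $\boldsymbol{\xi}\in\mathbb{R}^s$, and let $\mathcal{F}$ be a set of probability distributions for $\boldsymbol{\xi}$. For each $F\in\mathcal{F}$ let $g_F(\cdot)$ be a risk measure (the inner risk measure) applied to the random variable $H(\mathbf{x},\boldsymbol{\xi})$, and let $\mu(\cdot)$ be a risk measure (the outer risk measure) applied to the random variable $F\mapsto g_F(H(\mathbf{x},\boldsymbol{\xi}))$. Consider the optimization problem $$\min_{\mathbf{x}\in\mathcal{X}}\ \mu\big(g_F(H(\mathbf{x},\boldsymbol{\xi}))\big).$$ Suppose that: 1. $H(\mathbf{x},\boldsymbol{\xi})$ is convex in $\mathbf{x}$ (for every $\boldsymbol{\xi}$); 2. $\mathcal{X}$ is convex; 3. $\mu(\cdot)$ is a convex risk measure; 4. $g_F(\cdot)$ is a convex risk measure for each $F\in\mathcal{F}$. Then the problem is a convex optimization problem, i.e. $\mathbf{x}\mapsto\mu(g_F(H(\mathbf{x},\boldsymbol{\xi})))$ is a convex function on the convex set $\mathcal{X}$.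
   Context: Risk measure: let $\mathcal{L}$ be a set of real-valued random variables on a sample space $\Omega$. A functional $\rho:\mathcal{L}\to\mathbb{R}$ is a risk measure if it satisfies (monotonicity) $X\geq Y$ implies $\rho(X)\geq\rho(Y)$ for $X,Y\in\mathcal{L}$, where $X\ge Y$ means $X(\omega)\geq Y(\omega)$ for every $\omega\in\Omega$; and (translation invariance) $\rho(X+c)=\rho(X)+c$ for all $X\in\mathcal{L}$, $c\in\mathbb{R}$. It is a convex risk measure if in addition $\rho(\lambda X+(1-\lambda)Y)\leq\lambda\rho(X)+(1-\lambda)\rho(Y)$ for all $X,Y\in\mathcal{L}$ and $\lambda\in[0,1]$. Composite setting: for fixed $\mathbf{x}$, $Y(\mathbf{x})=H(\mathbf{x},\boldsymbol{\xi})$ is a random variable on the sample space $\Omega_0$ of $\boldsymbol{\xi}$. The risk measure $g_F$ is defined on random variables on $\Omega_0$ and depends on the distribution $F$ of $\boldsymbol{\xi}$. The set of distributions $\mathcal{F}$ (also denoted $\Omega_1$) is itself the sample space of a probability space $(\Omega_1,\Sigma_1,\mathbb{P}_1)$, so that $Z(\mathbf{x}):F\mapsto g_F(Y(\mathbf{x}))$ is a real-valued random variable on $\Omega_1$. The outer risk measure is a functional $\mu:\mathcal{Z}\to\mathbb{R}$ on a linear space $\mathcal{Z}$ of random variables on $\Omega_1$ containing the $Z(\mathbf{x})$, and $\mu(g_F(H(\mathbf{x},\boldsymbol{\xi})))$ means $\mu(Z(\mathbf{x}))$. The domains of the $g_F$ and of $\mu$ are taken to be linear spaces rich enough for all of these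 expressions, and the corresponding expressions with $H(\mathbf{x},\boldsymbol{\xi})$ replaced by convex combinations $\lambda H(\mathbf{x},\boldsymbol{\xi})+(1-\lambda)H(\mathbf{y},\boldsymbol{\xi})$, to be well defined. *)

theory Defs
  imports "HOL-Probability.Probability"
begin

text \<open>
  A random variable on a sample space is represented by a total function, of which only the
  values on \<^term>\<open>space M\<close> matter: a risk measure takes the same value on any two
  functions in its domain that agree there, because monotonicity only compares values on
  \<^term>\<open>space M\<close>.
\<close>

definition rv_space :: "'a measure \<Rightarrow> ('a \<Rightarrow> real) set \<Rightarrow> bool" where
  "rv_space M L \<longleftrightarrow>
     L \<subseteq> borel_measurable M \<and>
     (\<forall>c. (\<lambda>_. c) \<in> L) \<and>
     (\<forall>X\<in>L. \<forall>Y\<in>L. (\<lambda>\<omega>. X \<omega> + Y \<omega>) \<in> L) \<and>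
     (\<forall>X\<in>L. \<forall>c. (\<lambda>\<omega>. c * X \<omega>) \<in> L)"

text \<open>
  The domain \<open>L\<close> is meant to satisfy \<^const>\<open>rv_space\<close>, so that the translates and convex
  combinations below stay in \<open>L\<close>. Only the set \<^term>\<open>space M\<close> enters here: monotonicity is
  with respect to the order at every sample point, not almost everywhere.
\<close>

definition risk_measure :: "'a measure \<Rightarrow> ('a \<Rightarrow> real) set \<Rightarrow> (('a \<Rightarrow> real) \<Rightarrow> real) \<Rightarrow> bool" where
  "risk_measure M L \<rho> \<longleftrightarrow>
     (\<forall>X\<in>L. \<forall>Y\<in>L. (\<forall>\<omega>\<in>space M. X \<omega> \<ge> Y \<omega>) \<longrightarrow> \<rho> X \<ge> \<rho> Y) \<and>
     (\<forall>X\<in>L. \<forall>c. \<rho> (\<lambda>\<omega>. X \<omega> + c) = \<rho> X + c)"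

definition convex_risk_measure ::
    "'a measure \<Rightarrow> ('a \<Rightarrow> real) set \<Rightarrow> (('a \<Rightarrow> real) \<Rightarrow> real) \<Rightarrow> bool" where
  "convex_risk_measure M L \<rho> \<longleftrightarrow>
     risk_measure M L \<rho> \<and>
     (\<forall>X\<in>L. \<forall>Y\<in>L. \<forall>t\<in>{0..1}.
        \<rho> (\<lambda>\<omega>. t * X \<omega> + (1 - t) * Y \<omega>) \<le> t * \<rho> X + (1 - t) * \<rho> Y)"

text \<open>
  \<open>F\<close> is a distribution for \<open>\<xi>\<close> if \<open>\<xi>\<close> has law \<open>F\<close> under some probability measure on the
  measurable space \<open>M\<close>; the measure carried by \<open>M\<close> itself plays no role.
\<close>

definition distribution_for ::
    "'a measure \<Rightarrow> ('a \<Rightarrow> 'b::topological_space) \<Rightarrow> 'b measure \<Rightarrow> bool" where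
  "distribution_for M \<xi> F \<longleftrightarrow>
     (\<exists>P. prob_space P \<and> sets P = sets M \<and> distr P borel \<xi> = F)"

end

(* A convex risk measure turns a family of random variables that is pointwise convex in a parameter
   into a convex function of that parameter. Applied to each inner g_F it makes the family of random
   variables F |-> g_F(H(x, xi)) pointwise convex in x, and applied to the outer mu it
   concludes. *)

theory Submission
  imports Defs
begin

lemma rv_space_linear_combination:
  assumes "rv_space M L" "X \<in> L" "Y \<in> L"
  shows "(\<lambda>\<omega>. a * X \<omega> + b * Y \<omega>) \<in> L"
  using assms unfolding rv_space_def by simp

lemma convex_risk_measure_mono:
  assumes "convex_risk_measure M L \<rho>" "X \<in> L" "Y \<in> L"
    and "\<And>\<omega>. \<omega> \<in> space M \<Longrightarrow> X \<omega> \<le> Y \<omega>"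
  shows "\<rho> X \<le> \<rho> Y"
  using assms unfolding convex_risk_measure_def risk_measure_def by simp

lemma convex_risk_measure_convex:
  assumes "convex_risk_measure M L \<rho>" "X \<in> L" "Y \<in> L" "0 \<le> t" "t \<le> 1"
  shows "\<rho> (\<lambda>\<omega>. t * X \<omega> + (1 - t) * Y \<omega>) \<le> t * \<rho> X + (1 - t) * \<rho> Y"
  using assms unfolding convex_risk_measure_def by simp

text \<open>Convexity at each sample point bounds the random variable at a convex combination by the
  same combination of random variables; monotonicity carries this bound through
  \<open>\<rho>\<close>, and convexity of \<open>\<rho>\<close> then splits the right-hand
  side.\<close>

lemma convex_on_convex_risk_measure:
  fixes f :: "'b::real_vector \<Rightarrow> 'a \<Rightarrow> real"
  assumes L: "rv_space M L" and \<rho>: "convex_risk_measure M L \<rho>"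
    and f: "\<And>x. x \<in> S \<Longrightarrow> f x \<in> L"
    and conv: "\<And>\<omega>. \<omega> \<in> space M \<Longrightarrow> convex_on S (\<lambda>x. f x \<omega>)"
    and S: "convex S"
  shows "convex_on S (\<lambda>x. \<rho> (f x))"
proof (rule convex_onI)
  fix t :: real and x y
  assume t: "0 < t" "t < 1" and x: "x \<in> S" and y: "y \<in> S"
  let ?z = "(1 - t) *\<^sub>R x + t *\<^sub>R y"
  let ?W = "\<lambda>\<omega>. (1 - t) * f x \<omega> + t * f y \<omega>"
  \<comment> \<open>Convexity of \<open>S\<close> keeps \<open>?z\<close> in the parameter set,
    where \<open>f ?z\<close> is known to lie in \<open>L\<close>.\<close>
  have z: "?z \<in> S"
    using S x y t by (simp add: convex_alt)
  have "\<rho> (f ?z) \<le> \<rho> ?W"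
  \<comment> \<open>Monotonicity compares members of \<open>L\<close> only, so the mixture
    \<open>?W\<close> must be placed in \<open>L\<close> first; linearity of the space does
    this.\<close>
  proof (rule convex_risk_measure_mono[OF \<rho> f[OF z]])
    show "?W \<in> L"
      using rv_space_linear_combination[OF L f[OF x] f[OF y]] .
    show "f ?z \<omega> \<le> ?W \<omega>" if "\<omega> \<in> space M" for \<omega>
      using convex_onD[OF conv[OF that]] t x y by simp
  qed
  also have "\<rho> ?W \<le> (1 - t) * \<rho> (f x) + t * \<rho> (f y)"
    \<comment> \<open>The weight \<open>1 - t\<close> appears because \<open>convex_on\<close> puts
      \<open>t\<close> on the second point, whereas the definition of a convex risk measure puts it
      on the first.\<close>
    using convex_risk_measure_convex[OF \<rho> f[OF x] f[OF y], of "1 - t"] t by simp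
  finally show "\<rho> (f ?z) \<le> (1 - t) * \<rho> (f x) + t * \<rho> (f y)" .
qed (rule S)

theorem proposition1:
  fixes \<X> :: "(real ^ 'n) set"
    and H :: "real ^ 'n \<Rightarrow> real ^ 's \<Rightarrow> real"
    and \<Omega>\<^sub>0 :: "'w measure"
    and \<xi> :: "'w \<Rightarrow> real ^ 's"
    and \<F> :: "(real ^ 's) measure set"
    and \<Omega>\<^sub>1 :: "(real ^ 's) measure measure"
    and L :: "(real ^ 's) measure \<Rightarrow> ('w \<Rightarrow> real) set"
    and g :: "(real ^ 's) measure \<Rightarrow> ('w \<Rightarrow> real) \<Rightarrow> real"
    and \<Z> :: "((real ^ 's) measure \<Rightarrow> real) set"
    and \<mu> :: "((real ^ 's) measure \<Rightarrow> real) \<Rightarrow> real"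
  assumes "\<xi> \<in> borel_measurable \<Omega>\<^sub>0"
    and "\<forall>F\<in>\<F>. distribution_for \<Omega>\<^sub>0 \<xi> F"
    and "prob_space \<Omega>\<^sub>1" and "space \<Omega>\<^sub>1 = \<F>"
    and "\<forall>F\<in>\<F>. rv_space \<Omega>\<^sub>0 (L F)"
    and "\<forall>F\<in>\<F>. \<forall>x\<in>\<X>. (\<lambda>\<omega>. H x (\<xi> \<omega>)) \<in> L F"
    and "rv_space \<Omega>\<^sub>1 \<Z>"
    and "\<forall>x\<in>\<X>. (\<lambda>F. g F (\<lambda>\<omega>. H x (\<xi> \<omega>))) \<in> \<Z>"
    and "\<forall>x\<in>\<X>. \<forall>y\<in>\<X>. \<forall>t\<in>{0..1}.
           (\<lambda>F. g F (\<lambda>\<omega>. t * H x (\<xi> \<omega>) + (1 - t) * H y (\<xi> \<omega>))) \<in> \<Z>"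
    and "\<forall>z. convex_on UNIV (\<lambda>x. H x z)"
    and "convex \<X>"
    and "convex_risk_measure \<Omega>\<^sub>1 \<Z> \<mu>"
    and "\<forall>F\<in>\<F>. convex_risk_measure \<Omega>\<^sub>0 (L F) (g F)"
  shows "convex_on \<X> (\<lambda>x. \<mu> (\<lambda>F. g F (\<lambda>\<omega>. H x (\<xi> \<omega>))))"
\<comment> \<open>Outer level: the sample points are the distributions \<open>F\<close>, and what
  remains is convexity in \<open>x\<close> of the inner risk for each fixed
  \<open>F\<close>.\<close>
proof (rule convex_on_convex_risk_measure[where f = "\<lambda>x F. g F (\<lambda>\<omega>. H x (\<xi> \<omega>))",
        OF assms(7) assms(12) _ _ assms(11)])
  show "(\<lambda>F. g F (\<lambda>\<omega>. H x (\<xi> \<omega>))) \<in> \<Z>" if "x \<in> \<X>" for x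
    using assms(8) that by blast
  fix F
  assume "F \<in> space \<Omega>\<^sub>1"
  then have F: "F \<in> \<F>"
    using assms(4) by simp
  show "convex_on \<X> (\<lambda>x. g F (\<lambda>\<omega>. H x (\<xi> \<omega>)))"
  \<comment> \<open>Inner level: with \<open>F\<close> fixed, the same lemma applies to
    \<open>g F\<close> on \<open>L F\<close>, and pointwise convexity is now that of the loss at the
    value \<open>\<xi> \<omega>\<close>.\<close>
  proof (rule convex_on_convex_risk_measure[where f = "\<lambda>x \<omega>. H x (\<xi> \<omega>)",
        OF _ _ _ _ assms(11)])
    show "rv_space \<Omega>\<^sub>0 (L F)" "convex_risk_measure \<Omega>\<^sub>0 (L F) (g F)"
      using assms(5,13) F by blast+
    show "(\<lambda>\<omega>. H x (\<xi> \<omega>)) \<in> L F" if "x \<in> \<X>" for x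
      using assms(6) F that by blast
    show "convex_on \<X> (\<lambda>x. H x (\<xi> \<omega>))" for \<omega>
      using assms(10,11) convex_on_subset[of UNIV "\<lambda>x. H x (\<xi> \<omega>)" \<X>] by simp
  qed
qed

end
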